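(* Let $g$ and $\bar g$ be Riemannian metrics on an $m$-dimensional manifold $M$ which are $PQ^{\epsilon}$-projective (for some $(1,1)$-tensors $P,Q$ and a real number $\epsilon\neq 1,m+1$ satisfying the compatibility conditions). If $g$ and $\bar g$ are not affinely equivalent, then $\epsilon$ is either zero or an odd negative integer, i.e. $\epsilon\in\{0,-1,-3,-5,-7,\dots\}$.
   Context: Let $g,\bar g$ be (positive definite) Riemannian metrics on a smooth $m$-dimensional manifold $M$ with Levi-Civita connections $\nabla,\bar\nabla$. Let $P,Q$ be $(1,1)$-tensors on $M$ (endomorphism fields of $TM$) and $\epsilon$ a real number (a constant), $\epsilon\neq 1$ and $\epsilon\neq m+1$, satisfying the compatibility conditions $$g(PX,Y)=-g(X,PY),\quad g(QX,Y)=-g(X,QY),\quad \bar g(PX,Y)=-\bar g(X,PY),\quad \bar g(QX,Y)=-\bar g(X,QY),\quad PQ=\epsilon\, Id,$$ for all $X,Y$, where $Id$ is the identity on $TM$. The metrics $g,\bar g$ are called $PQ^{\epsilon}$-projective if there is a $1$-form $\Phi$ on $M$ such that for all vector fields $X,Y$ $$\bar\nabla_XY-\nabla_XY=\Phi(X)Y+\Phi(Y)X-\Phi(PX)QY-\Phi(PY)QX .$$ The metrics are called affinely equivalent if $\nabla=\bar\nabla$ on $M$. *)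

theory Defs
  imports "HOL-Analysis.Analysis"
begin

section \<open>Smooth maps between open subsets of normed spaces\<close>

text \<open>For open \<open>S\<close> and a finite-dimensional domain the predicate \<open>Ck_on k f S\<close> says that all
  iterated directional derivatives up to order \<open>k\<close> exist and are continuous, i.e. that \<open>f\<close> is of
  class \<open>C\<^sup>k\<close> on \<open>S\<close>.\<close>

primrec Ck_on ::
  "nat \<Rightarrow> ('e::real_normed_vector \<Rightarrow> 'f::real_normed_vector) \<Rightarrow> 'e set \<Rightarrow> bool" where
  "Ck_on 0 f S \<longleftrightarrow> continuous_on S f"
| "Ck_on (Suc k) f S \<longleftrightarrow> (\<forall>x\<in>S. f differentiable (at x)) \<and>
     (\<forall>v. Ck_on k (\<lambda>x. frechet_derivative f (at x) v) S)"

definition smooth_on ::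
  "('e::real_normed_vector \<Rightarrow> 'f::real_normed_vector) \<Rightarrow> 'e set \<Rightarrow> bool" where
  "smooth_on f S \<longleftrightarrow> (\<forall>k. Ck_on k f S)"


section \<open>Smooth manifolds\<close>

text \<open>A chart is a pair of a domain and a coordinate map; the values of the coordinate map outside
  the domain are irrelevant. The manifold is the set \<open>topspace T\<close>, and its dimension is \<open>DIM('e)\<close>.\<close>

type_synonym ('a, 'e) chart = "'a set \<times> ('a \<Rightarrow> 'e)"

definition coord_inv :: "('a, 'e) chart \<Rightarrow> 'e \<Rightarrow> 'a" where
  "coord_inv c = inv_into (fst c) (snd c)"

definition transition :: "('a, 'e) chart \<Rightarrow> ('a, 'e) chart \<Rightarrow> 'e \<Rightarrow> 'e" where
  "transition c d = snd d \<circ> coord_inv c"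

definition smooth_atlas ::
  "'a topology \<Rightarrow> ('a, 'e::euclidean_space) chart set \<Rightarrow> bool" where
  "smooth_atlas T A \<longleftrightarrow>
     (\<forall>c\<in>A. openin T (fst c) \<and> open (snd c ` fst c) \<and>
        homeomorphic_map (subtopology T (fst c)) (top_of_set (snd c ` fst c)) (snd c)) \<and>
     (\<Union>c\<in>A. fst c) = topspace T \<and>
     (\<forall>c\<in>A. \<forall>d\<in>A. smooth_on (transition c d) (snd c ` (fst c \<inter> fst d)))"

definition smooth_manifold ::
  "'a topology \<Rightarrow> ('a, 'e::euclidean_space) chart set \<Rightarrow> bool" where
  "smooth_manifold T A \<longleftrightarrow> Hausdorff_space T \<and> second_countable T \<and> smooth_atlas T A"

definition smooth_fun ::
  "('a, 'e::euclidean_space) chart set \<Rightarrow> ('a \<Rightarrow> real) \<Rightarrow> bool" where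
  "smooth_fun A f \<longleftrightarrow> (\<forall>c\<in>A. smooth_on (f \<circ> coord_inv c) (snd c ` fst c))"


section \<open>Tangent vectors and vector fields\<close>

text \<open>A tangent vector at \<open>p\<close> is the family of its components in all charts around \<open>p\<close>, related by
  the differentials of the transition maps. The components in the remaining charts are set to zero,
  so that two tangent vectors at \<open>p\<close> coincide iff they are equal as functions.\<close>

type_synonym ('a, 'e) tvec = "('a, 'e) chart \<Rightarrow> 'e"

definition tangent_space ::
  "('a, 'e::euclidean_space) chart set \<Rightarrow> 'a \<Rightarrow> ('a, 'e) tvec set" where
  "tangent_space A p = {v.
     (\<forall>c\<in>A. \<forall>d\<in>A. p \<in> fst c \<and> p \<in> fst d \<longrightarrow>
        v d = frechet_derivative (transition c d) (at (snd c p)) (v c)) \<and>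
     (\<forall>c. \<not> (c \<in> A \<and> p \<in> fst c) \<longrightarrow> v c = 0)}"

definition tzero :: "('a, 'e::real_vector) tvec" where
  "tzero = (\<lambda>c. 0)"

definition tadd :: "('a, 'e::real_vector) tvec \<Rightarrow> ('a, 'e) tvec \<Rightarrow> ('a, 'e) tvec"
    (infixl "\<oplus>\<^sub>t" 65) where
  "v \<oplus>\<^sub>t w = (\<lambda>c. v c + w c)"

definition tdiff :: "('a, 'e::real_vector) tvec \<Rightarrow> ('a, 'e) tvec \<Rightarrow> ('a, 'e) tvec"
    (infixl "\<ominus>\<^sub>t" 65) where
  "v \<ominus>\<^sub>t w = (\<lambda>c. v c - w c)"

definition tscale :: "real \<Rightarrow> ('a, 'e::real_vector) tvec \<Rightarrow> ('a, 'e) tvec"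
    (infixr "\<odot>\<^sub>t" 75) where
  "r \<odot>\<^sub>t v = (\<lambda>c. r *\<^sub>R v c)"

text \<open>The directional derivative \<open>v f\<close> of a smooth function at \<open>p\<close>, computed in some chart around
  \<open>p\<close>; by the transformation law for tangent vectors it does not depend on that chart.\<close>

definition tderiv ::
  "('a, 'e::euclidean_space) chart set \<Rightarrow> 'a \<Rightarrow> ('a, 'e) tvec \<Rightarrow> ('a \<Rightarrow> real) \<Rightarrow> real" where
  "tderiv A p v f =
     (let c = (SOME c. c \<in> A \<and> p \<in> fst c)
      in frechet_derivative (f \<circ> coord_inv c) (at (snd c p)) (v c))"

text \<open>Vector fields, functions and tensor fields are total HOL functions, but only their values on
  \<open>topspace T\<close> (and, for tensors, on the tangent spaces) matter.\<close>

definition vector_fields ::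
  "'a topology \<Rightarrow> ('a, 'e::euclidean_space) chart set \<Rightarrow> ('a \<Rightarrow> ('a, 'e) tvec) set" where
  "vector_fields T A = {X.
     (\<forall>p\<in>topspace T. X p \<in> tangent_space A p) \<and>
     (\<forall>c\<in>A. smooth_on (\<lambda>x. X (coord_inv c x) c) (snd c ` fst c))}"

definition lie_bracket ::
  "('a, 'e::euclidean_space) chart set \<Rightarrow> ('a \<Rightarrow> ('a, 'e) tvec) \<Rightarrow> ('a \<Rightarrow> ('a, 'e) tvec)
     \<Rightarrow> 'a \<Rightarrow> ('a, 'e) tvec" where
  "lie_bracket A X Y p = (\<lambda>c. if c \<in> A \<and> p \<in> fst c
     then frechet_derivative (\<lambda>x. Y (coord_inv c x) c) (at (snd c p)) (X p c)
        - frechet_derivative (\<lambda>x. X (coord_inv c x) c) (at (snd c p)) (Y p c)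
     else 0)"


section \<open>Tensor fields\<close>

definition one_form ::
  "'a topology \<Rightarrow> ('a, 'e::euclidean_space) chart set \<Rightarrow> ('a \<Rightarrow> ('a, 'e) tvec \<Rightarrow> real) \<Rightarrow> bool" where
  "one_form T A \<Phi> \<longleftrightarrow>
     (\<forall>p\<in>topspace T. \<forall>v\<in>tangent_space A p. \<forall>w\<in>tangent_space A p. \<forall>r.
        \<Phi> p (v \<oplus>\<^sub>t w) = \<Phi> p v + \<Phi> p w \<and> \<Phi> p (r \<odot>\<^sub>t v) = r * \<Phi> p v) \<and>
     (\<forall>X\<in>vector_fields T A. smooth_fun A (\<lambda>p. \<Phi> p (X p)))"

definition endo_field ::
  "'a topology \<Rightarrow> ('a, 'e::euclidean_space) chart set
     \<Rightarrow> ('a \<Rightarrow> ('a, 'e) tvec \<Rightarrow> ('a, 'e) tvec) \<Rightarrow> bool" where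
  "endo_field T A P \<longleftrightarrow>
     (\<forall>p\<in>topspace T. \<forall>v\<in>tangent_space A p. \<forall>w\<in>tangent_space A p. \<forall>r.
        P p v \<in> tangent_space A p \<and>
        P p (v \<oplus>\<^sub>t w) = P p v \<oplus>\<^sub>t P p w \<and> P p (r \<odot>\<^sub>t v) = r \<odot>\<^sub>t P p v) \<and>
     (\<forall>X\<in>vector_fields T A. (\<lambda>p. P p (X p)) \<in> vector_fields T A)"

definition riemannian_metric ::
  "'a topology \<Rightarrow> ('a, 'e::euclidean_space) chart set
     \<Rightarrow> ('a \<Rightarrow> ('a, 'e) tvec \<Rightarrow> ('a, 'e) tvec \<Rightarrow> real) \<Rightarrow> bool" where
  "riemannian_metric T A g \<longleftrightarrow>
     (\<forall>p\<in>topspace T. \<forall>u\<in>tangent_space A p. \<forall>v\<in>tangent_space A p. \<forall>w\<in>tangent_space A p. \<forall>r.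
        g p (u \<oplus>\<^sub>t v) w = g p u w + g p v w \<and> g p (r \<odot>\<^sub>t v) w = r * g p v w \<and>
        g p v w = g p w v \<and> (v \<noteq> tzero \<longrightarrow> g p v v > 0)) \<and>
     (\<forall>X\<in>vector_fields T A. \<forall>Y\<in>vector_fields T A. smooth_fun A (\<lambda>p. g p (X p) (Y p)))"


section \<open>Connections\<close>

definition affine_connection ::
  "'a topology \<Rightarrow> ('a, 'e::euclidean_space) chart set
     \<Rightarrow> (('a \<Rightarrow> ('a, 'e) tvec) \<Rightarrow> ('a \<Rightarrow> ('a, 'e) tvec) \<Rightarrow> 'a \<Rightarrow> ('a, 'e) tvec) \<Rightarrow> bool" where
  "affine_connection T A D \<longleftrightarrow>
     (\<forall>X\<in>vector_fields T A. \<forall>Y\<in>vector_fields T A. D X Y \<in> vector_fields T A) \<and>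
     (\<forall>X\<in>vector_fields T A. \<forall>Y\<in>vector_fields T A. \<forall>Z\<in>vector_fields T A. \<forall>p\<in>topspace T.
        D (\<lambda>q. X q \<oplus>\<^sub>t Y q) Z p = D X Z p \<oplus>\<^sub>t D Y Z p \<and>
        D X (\<lambda>q. Y q \<oplus>\<^sub>t Z q) p = D X Y p \<oplus>\<^sub>t D X Z p) \<and>
     (\<forall>X\<in>vector_fields T A. \<forall>Y\<in>vector_fields T A. \<forall>f. smooth_fun A f \<longrightarrow> (\<forall>p\<in>topspace T.
        D (\<lambda>q. f q \<odot>\<^sub>t X q) Y p = f p \<odot>\<^sub>t D X Y p \<and>
        D X (\<lambda>q. f q \<odot>\<^sub>t Y q) p = tderiv A p (X p) f \<odot>\<^sub>t Y p \<oplus>\<^sub>t f p \<odot>\<^sub>t D X Y p))"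

text \<open>By the fundamental theorem of Riemannian geometry, for a metric \<open>g\<close> this determines \<open>D X Y\<close>
  on \<open>topspace T\<close> for all vector fields \<open>X\<close>, \<open>Y\<close>.\<close>

definition levi_civita_connection ::
  "'a topology \<Rightarrow> ('a, 'e::euclidean_space) chart set
     \<Rightarrow> ('a \<Rightarrow> ('a, 'e) tvec \<Rightarrow> ('a, 'e) tvec \<Rightarrow> real)
     \<Rightarrow> (('a \<Rightarrow> ('a, 'e) tvec) \<Rightarrow> ('a \<Rightarrow> ('a, 'e) tvec) \<Rightarrow> 'a \<Rightarrow> ('a, 'e) tvec) \<Rightarrow> bool" where
  "levi_civita_connection T A g D \<longleftrightarrow>
     affine_connection T A D \<and>
     (\<forall>X\<in>vector_fields T A. \<forall>Y\<in>vector_fields T A. \<forall>p\<in>topspace T.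
        D X Y p \<ominus>\<^sub>t D Y X p = lie_bracket A X Y p) \<and>
     (\<forall>X\<in>vector_fields T A. \<forall>Y\<in>vector_fields T A. \<forall>Z\<in>vector_fields T A. \<forall>p\<in>topspace T.
        tderiv A p (X p) (\<lambda>q. g q (Y q) (Z q)) = g p (D X Y p) (Z p) + g p (Y p) (D X Z p))"

text \<open>To be applied to the Levi-Civita connections of two metrics.\<close>

definition affinely_equivalent ::
  "'a topology \<Rightarrow> ('a, 'e::euclidean_space) chart set
     \<Rightarrow> (('a \<Rightarrow> ('a, 'e) tvec) \<Rightarrow> ('a \<Rightarrow> ('a, 'e) tvec) \<Rightarrow> 'a \<Rightarrow> ('a, 'e) tvec)
     \<Rightarrow> (('a \<Rightarrow> ('a, 'e) tvec) \<Rightarrow> ('a \<Rightarrow> ('a, 'e) tvec) \<Rightarrow> 'a \<Rightarrow> ('a, 'e) tvec) \<Rightarrow> bool" where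
  "affinely_equivalent T A D D' \<longleftrightarrow>
     (\<forall>X\<in>vector_fields T A. \<forall>Y\<in>vector_fields T A. \<forall>p\<in>topspace T. D X Y p = D' X Y p)"


section \<open>PQ-projectivity\<close>

definition skew_wrt ::
  "'a topology \<Rightarrow> ('a, 'e::euclidean_space) chart set
     \<Rightarrow> ('a \<Rightarrow> ('a, 'e) tvec \<Rightarrow> ('a, 'e) tvec \<Rightarrow> real)
     \<Rightarrow> ('a \<Rightarrow> ('a, 'e) tvec \<Rightarrow> ('a, 'e) tvec) \<Rightarrow> bool" where
  "skew_wrt T A g P \<longleftrightarrow>
     (\<forall>p\<in>topspace T. \<forall>v\<in>tangent_space A p. \<forall>w\<in>tangent_space A p.
        g p (P p v) w = - g p v (P p w))"

definition pq_compatible ::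
  "'a topology \<Rightarrow> ('a, 'e::euclidean_space) chart set
     \<Rightarrow> ('a \<Rightarrow> ('a, 'e) tvec \<Rightarrow> ('a, 'e) tvec \<Rightarrow> real)
     \<Rightarrow> ('a \<Rightarrow> ('a, 'e) tvec \<Rightarrow> ('a, 'e) tvec \<Rightarrow> real)
     \<Rightarrow> ('a \<Rightarrow> ('a, 'e) tvec \<Rightarrow> ('a, 'e) tvec) \<Rightarrow> ('a \<Rightarrow> ('a, 'e) tvec \<Rightarrow> ('a, 'e) tvec)
     \<Rightarrow> real \<Rightarrow> bool" where
  "pq_compatible T A g g' P Q \<epsilon> \<longleftrightarrow>
     skew_wrt T A g P \<and> skew_wrt T A g Q \<and> skew_wrt T A g' P \<and> skew_wrt T A g' Q \<and>
     (\<forall>p\<in>topspace T. \<forall>v\<in>tangent_space A p. P p (Q p v) = \<epsilon> \<odot>\<^sub>t v)"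

text \<open>To be applied to the Levi-Civita connections \<open>D\<close> of \<open>g\<close> and \<open>D'\<close> of \<open>g'\<close>.\<close>

definition pq_projective ::
  "'a topology \<Rightarrow> ('a, 'e::euclidean_space) chart set
     \<Rightarrow> (('a \<Rightarrow> ('a, 'e) tvec) \<Rightarrow> ('a \<Rightarrow> ('a, 'e) tvec) \<Rightarrow> 'a \<Rightarrow> ('a, 'e) tvec)
     \<Rightarrow> (('a \<Rightarrow> ('a, 'e) tvec) \<Rightarrow> ('a \<Rightarrow> ('a, 'e) tvec) \<Rightarrow> 'a \<Rightarrow> ('a, 'e) tvec)
     \<Rightarrow> ('a \<Rightarrow> ('a, 'e) tvec \<Rightarrow> ('a, 'e) tvec) \<Rightarrow> ('a \<Rightarrow> ('a, 'e) tvec \<Rightarrow> ('a, 'e) tvec)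
     \<Rightarrow> bool" where
  "pq_projective T A D D' P Q \<longleftrightarrow>
     (\<exists>\<Phi>. one_form T A \<Phi> \<and>
        (\<forall>X\<in>vector_fields T A. \<forall>Y\<in>vector_fields T A. \<forall>p\<in>topspace T.
           D' X Y p \<ominus>\<^sub>t D X Y p =
             \<Phi> p (X p) \<odot>\<^sub>t Y p \<oplus>\<^sub>t \<Phi> p (Y p) \<odot>\<^sub>t X p
               \<ominus>\<^sub>t \<Phi> p (P p (X p)) \<odot>\<^sub>t Q p (Y p) \<ominus>\<^sub>t \<Phi> p (P p (Y p)) \<odot>\<^sub>t Q p (X p)))"

end

theory Submission
  imports Defs
begin

text \<open>The argument works at a single point \<open>p\<close> where \<open>\<Phi>\<close> does not vanish and gives
  \<open>\<epsilon> = 0\<close> or \<open>\<epsilon> = -1\<close>.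

  Write \<open>S\<^sub>X = D'\<^sub>X - D\<^sub>X\<close>, and let \<open>E\<close> be an eigenspace at \<open>p\<close> of \<open>g'\<close> relative to \<open>g\<close>, that is,
  \<open>g'(z, y) = \<rho> g(z, y)\<close> for \<open>y\<close> in \<open>E\<close> and all \<open>z\<close>. It is invariant under \<open>P\<close>, because \<open>P\<close> is
  skew for both metrics. Skewness of \<open>P\<close> means that \<open>g(PY, Z) + g(Y, PZ)\<close> vanishes identically; its
  derivative along \<open>X\<close> is
  \<open>g(D\<^sub>X(PY), Z) + g(PY, D\<^sub>XZ) + g(D\<^sub>XY, PZ) + g(Y, D\<^sub>X(PZ)) = 0\<close>,
  and the same holds for \<open>g'\<close> and \<open>D' = D + S\<close>
  (\<open>metric_compatible_skew_derivative\<close>). If \<open>Y\<close> and \<open>Z\<close> lie in \<open>E\<close> at \<open>p\<close>, so do \<open>PY\<close> and \<open>PZ\<close>, and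
  every \<open>g'\<close> in the second identity may be replaced by \<open>\<rho> g\<close>. Subtracting the first identity removes
  all derivatives and leaves the pointwise condition
  \<open>g(S\<^sub>X(PY), Z) + g(PY, S\<^sub>XZ) + g(S\<^sub>XY, PZ) + g(Y, S\<^sub>X(PZ)) = 0\<close>.

  Since the eigenspaces span, some \<open>E\<close> contains a nonzero \<open>v\<close> such that \<open>\<Phi>\<close> is a nonzero multiple of
  \<open>g(v, \<cdot>)\<close> on \<open>E\<close> (\<open>eigenvector_representing_form\<close>). Inserting the formula for \<open>S\<close> and
  \<open>X = Y = v\<close>, \<open>Z = Pv\<close> turns the condition into \<open>g(v, v) g(Pv, Pv) (1 + \<epsilon>) = 0\<close>. So either
  \<open>\<epsilon> = -1\<close>, or \<open>Pv = 0\<close>; in the latter case \<open>0 = g(Pv, Qv) = - g(v, PQv) = - \<epsilon> g(v, v)\<close> gives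
  \<open>\<epsilon> = 0\<close> (\<open>pq_constant_cases\<close>).

  The differentiated identities speak of globally defined vector fields. The linear algebra is
  therefore carried out on the subspace of those tangent vectors at \<open>p\<close> that are values of global
  fields. This subspace is preserved by \<open>P\<close>, \<open>Q\<close> and contains the values of all \<open>D X Y\<close>, so that no
  cut-off functions have to be constructed.\<close>


section \<open>Symmetric bilinear forms on a subspace\<close>

definition symmetric_form_on :: "'v::real_vector set \<Rightarrow> ('v \<Rightarrow> 'v \<Rightarrow> real) \<Rightarrow> bool" where
  "symmetric_form_on W g \<longleftrightarrow>
     (\<forall>x\<in>W. \<forall>y\<in>W. g x y = g y x) \<and>
     (\<forall>x\<in>W. \<forall>y\<in>W. \<forall>z\<in>W. g (x + y) z = g x z + g y z) \<and>
     (\<forall>r. \<forall>x\<in>W. \<forall>y\<in>W. g (r *\<^sub>R x) y = r * g x y)"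

definition inner_product_on :: "'v::real_vector set \<Rightarrow> ('v \<Rightarrow> 'v \<Rightarrow> real) \<Rightarrow> bool" where
  "inner_product_on W g \<longleftrightarrow> symmetric_form_on W g \<and> (\<forall>x\<in>W. x \<noteq> 0 \<longrightarrow> g x x > 0)"

definition linear_form_on :: "'v::real_vector set \<Rightarrow> ('v \<Rightarrow> real) \<Rightarrow> bool" where
  "linear_form_on W \<phi> \<longleftrightarrow>
     (\<forall>x\<in>W. \<forall>y\<in>W. \<phi> (x + y) = \<phi> x + \<phi> y) \<and> (\<forall>r. \<forall>x\<in>W. \<phi> (r *\<^sub>R x) = r * \<phi> x)"

text \<open>The \<open>\<rho>\<close>-eigenspace of the \<open>g\<close>-self-adjoint operator \<open>B\<close> with \<open>h(z, y) = g(z, By)\<close>, described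
  by the two forms alone.\<close>

definition eigenspace_on ::
  "'v set \<Rightarrow> ('v \<Rightarrow> 'v \<Rightarrow> real) \<Rightarrow> ('v \<Rightarrow> 'v \<Rightarrow> real) \<Rightarrow> real \<Rightarrow> 'v set" where
  "eigenspace_on W g h \<rho> = {y\<in>W. \<forall>z\<in>W. h z y = \<rho> * g z y}"

context
  fixes W :: "'v::real_vector set" and g
  assumes W: "subspace W" and g: "symmetric_form_on W g"
begin

lemma form_commute: "x \<in> W \<Longrightarrow> y \<in> W \<Longrightarrow> g x y = g y x"
  using g by (auto simp: symmetric_form_on_def)

lemma form_add_left: "x \<in> W \<Longrightarrow> y \<in> W \<Longrightarrow> z \<in> W \<Longrightarrow> g (x + y) z = g x z + g y z"
  using g by (auto simp: symmetric_form_on_def)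

lemma form_scaleR_left: "x \<in> W \<Longrightarrow> y \<in> W \<Longrightarrow> g (r *\<^sub>R x) y = r * g x y"
  using g by (auto simp: symmetric_form_on_def)

lemma form_add_right: "x \<in> W \<Longrightarrow> y \<in> W \<Longrightarrow> z \<in> W \<Longrightarrow> g z (x + y) = g z x + g z y"
  by (metis form_add_left form_commute W subspace_add)

lemma form_scaleR_right: "x \<in> W \<Longrightarrow> y \<in> W \<Longrightarrow> g y (r *\<^sub>R x) = r * g y x"
  by (metis form_scaleR_left form_commute W subspace_scale)

lemma form_diff_left: "x \<in> W \<Longrightarrow> y \<in> W \<Longrightarrow> z \<in> W \<Longrightarrow> g (x - y) z = g x z - g y z"
  using form_add_left[of "x - y" y z] W by (simp add: subspace_diff)

lemma form_diff_right: "x \<in> W \<Longrightarrow> y \<in> W \<Longrightarrow> z \<in> W \<Longrightarrow> g z (x - y) = g z x - g z y"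
  using form_add_right[of "x - y" y z] W by (simp add: subspace_diff)

lemmas form_simps = form_add_left form_scaleR_left form_add_right form_scaleR_right
  form_diff_left form_diff_right

end

text \<open>The form is only controlled on \<open>W\<close>; composing it with a linear retraction onto \<open>W\<close> gives a
  bilinear map on the whole finite-dimensional space, which is bounded.\<close>

lemma continuous_on_quadratic_form:
  fixes W :: "'e::euclidean_space set"
  assumes W: "subspace W" and h: "symmetric_form_on W h"
  shows "continuous_on W (\<lambda>x. h x x)"
proof -
  obtain \<pi> where \<pi>: "linear \<pi>" "range \<pi> \<subseteq> W" "\<And>x. x \<in> W \<Longrightarrow> \<pi> x = x"
    using linear_exists_left_inverse_on[of "\<lambda>x::'e. x" W] W
    by (auto simp: linear_ident image_subset_iff)
  have mem: "\<pi> x \<in> W" for x using \<pi>(2) by auto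
  have "bilinear (\<lambda>x y. h (\<pi> x) (\<pi> y))"
    unfolding bilinear_def
    by (auto intro!: linearI simp: linear_add[OF \<pi>(1)] linear_cmul[OF \<pi>(1)]
        form_simps[OF W h] mem)
  then have "bounded_bilinear (\<lambda>x y. h (\<pi> x) (\<pi> y))"
    by (simp add: bilinear_conv_bounded_bilinear)
  then have "continuous_on W (\<lambda>x. h (\<pi> x) (\<pi> x))"
    by (rule bounded_bilinear.continuous_on) (auto intro: continuous_on_id)
  then show ?thesis
    by (rule continuous_on_eq) (simp add: \<pi>(3))
qed

text \<open>This is the first-order condition at \<open>t = 0\<close> for a quadratic function with maximum \<open>0\<close> there.\<close>

lemma linear_coefficient_zero:
  fixes a b :: real
  assumes "\<And>t. 2 * t * b + t\<^sup>2 * a \<le> 0"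
  shows "b = 0"
proof (rule ccontr)
  assume b: "b \<noteq> 0"
  \<comment> \<open>small enough for the linear term to outweigh the quadratic one, and of the sign of \<open>b\<close>\<close>
  define t where "t = b / (\<bar>a\<bar> + 1)"
  have "b = t * (\<bar>a\<bar> + 1)" by (simp add: t_def)
  then have "2 * t * b + t\<^sup>2 * a = t\<^sup>2 * (2 * (\<bar>a\<bar> + 1) + a)"
    by (simp add: power2_eq_square algebra_simps)
  moreover have "t\<^sup>2 > 0" using b by (simp add: t_def)
  moreover have "2 * (\<bar>a\<bar> + 1) + a > 0"
    using abs_ge_minus_self[of a] abs_ge_zero[of a] by argo
  ultimately show False using assms[of t] by (simp add: mult_le_0_iff)
qed

text \<open>A maximizer \<open>v\<close> of the Rayleigh quotient \<open>h(x, x) / g(x, x)\<close> exists by compactness of the unit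
  sphere of \<open>K\<close>, and the quotient is stationary at \<open>v\<close> in every direction of \<open>K\<close>. The inequality in
  the conclusion bounds \<open>\<rho>\<close> from below; it is what makes \<open>\<rho>\<close> positive in the next lemma.\<close>

lemma rayleigh_maximizer:
  fixes K :: "'e::euclidean_space set"
  assumes K: "subspace K" and nz: "x0 \<in> K" "x0 \<noteq> 0"
    and g: "inner_product_on K g" and h: "symmetric_form_on K h"
  obtains v \<rho> where "v \<in> K" "v \<noteq> 0"
    "\<And>x. x \<in> K \<Longrightarrow> h x x \<le> \<rho> * g x x" "\<And>y. y \<in> K \<Longrightarrow> h y v = \<rho> * g y v"
proof -
  have gs: "symmetric_form_on K g" and gpos: "\<And>x. x \<in> K \<Longrightarrow> x \<noteq> 0 \<Longrightarrow> g x x > 0"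
    using g by (auto simp: inner_product_on_def)
  define C where "C = K \<inter> sphere 0 1"
  have "compact C"
    unfolding C_def using closed_subspace[OF K] by (intro closed_Int_compact) auto
  moreover have normalized: "x /\<^sub>R norm x \<in> C" if "x \<in> K" "x \<noteq> 0" for x
    using that K by (simp add: C_def subspace_scale)
  then have "C \<noteq> {}" using nz by blast
  moreover have "continuous_on C (\<lambda>x. h x x / g x x)"
  proof (intro continuous_intros)
    show "continuous_on C (\<lambda>x. h x x)" "continuous_on C (\<lambda>x. g x x)"
      using continuous_on_quadratic_form[OF K] h gs
      by (auto simp: C_def intro: continuous_on_subset)
    show "\<forall>x\<in>C. g x x \<noteq> 0" using gpos by (force simp: C_def)
  qed
  ultimately obtain v where v: "v \<in> C" "\<And>y. y \<in> C \<Longrightarrow> h y y / g y y \<le> h v v / g v v"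
    using continuous_attains_sup[of C "\<lambda>x. h x x / g x x"] by blast
  define \<rho> where "\<rho> = h v v / g v v"
  have vK: "v \<in> K" "v \<noteq> 0" using v(1) by (auto simp: C_def)
  have le: "h x x \<le> \<rho> * g x x" if x: "x \<in> K" for x
  proof (cases "x = 0")
    case True
    have "h (0 *\<^sub>R v) v = 0" "g (0 *\<^sub>R v) v = 0" "h (0 *\<^sub>R v) (0 *\<^sub>R v) = 0" "g (0 *\<^sub>R v) (0 *\<^sub>R v) = 0"
      using vK K by (simp_all only: form_simps[OF K h] form_simps[OF K gs] subspace_scale)
    then show ?thesis using True by simp
  next
    case False
    have "h (x /\<^sub>R norm x) (x /\<^sub>R norm x) / g (x /\<^sub>R norm x) (x /\<^sub>R norm x) = h x x / g x x"
      using x K False by (simp add: form_simps[OF K h] form_simps[OF K gs] subspace_scale)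
    with v(2)[OF normalized[OF x False]] have "h x x / g x x \<le> \<rho>" by (simp add: \<rho>_def)
    then show ?thesis using gpos[OF x False] by (simp add: field_simps)
  qed
  have "h y v = \<rho> * g y v" if y: "y \<in> K" for y
  proof -
    have hv: "h v v = \<rho> * g v v" using gpos[OF vK] by (simp add: \<rho>_def)
    have "2 * t * (h y v - \<rho> * g y v) + t\<^sup>2 * (h y y - \<rho> * g y y) \<le> 0" for t
    proof -
      have "v + t *\<^sub>R y \<in> K" using K vK y by (simp add: subspace_add subspace_scale)
      from le[OF this] show ?thesis
        using K vK y hv form_commute[OF K h, of v y] form_commute[OF K gs, of v y]
        by (simp add: form_simps[OF K h] form_simps[OF K gs] subspace_add subspace_scale
            algebra_simps power2_eq_square)
    qed
    then have "h y v - \<rho> * g y v = 0" by (rule linear_coefficient_zero)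
    then show ?thesis by simp
  qed
  with vK le show thesis by (rule that)
qed

text \<open>The form \<open>\<phi>(x) \<phi>(y)\<close> has rank one, so an eigenvector \<open>v\<close> for its positive maximal Rayleigh
  quotient \<open>\<rho>\<close> satisfies \<open>\<phi>(v) \<phi> = \<rho> g(v, \<cdot>)\<close> with \<open>\<phi>(v) \<noteq> 0\<close>.\<close>

lemma riesz_on_subspace:
  fixes W :: "'e::euclidean_space set"
  assumes W: "subspace W" and g: "inner_product_on W g" and \<phi>: "linear_form_on W \<phi>"
  obtains u where "u \<in> W" "\<And>y. y \<in> W \<Longrightarrow> \<phi> y = g u y"
proof (cases "\<forall>x\<in>W. \<phi> x = 0")
  case True
  have gs: "symmetric_form_on W g" using g by (auto simp: inner_product_on_def)
  have "0 \<in> W" using W by (rule subspace_0)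
  moreover have "\<phi> y = g 0 y" if "y \<in> W" for y
    using form_scaleR_left[OF W gs \<open>0 \<in> W\<close> that, of 0] True that by simp
  ultimately show thesis by (rule that)
next
  case False
  then obtain x where x: "x \<in> W" "\<phi> x \<noteq> 0" by blast
  have gs: "symmetric_form_on W g" using g by (auto simp: inner_product_on_def)
  have "\<phi> (0 *\<^sub>R x) = 0" using \<phi> x unfolding linear_form_on_def by (metis mult_zero_left)
  then have x0: "x \<noteq> 0" using x(2) by auto
  have "symmetric_form_on W (\<lambda>x y. \<phi> x * \<phi> y)"
    using \<phi> by (auto simp: symmetric_form_on_def linear_form_on_def algebra_simps)
  from rayleigh_maximizer[OF W x(1) x0 g this] obtain v \<rho> where
    v: "v \<in> W" "v \<noteq> 0" "\<And>x. x \<in> W \<Longrightarrow> \<phi> x * \<phi> x \<le> \<rho> * g x x"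
      "\<And>y. y \<in> W \<Longrightarrow> \<phi> y * \<phi> v = \<rho> * g y v"
    by metis
  have "0 < \<phi> x * \<phi> x" using x(2) not_real_square_gt_zero by blast
  also have "\<dots> \<le> \<rho> * g x x" using v(3) x(1) by blast
  finally have "0 < \<rho> * g x x" .
  moreover have "g x x > 0" using g x(1) x0 by (auto simp: inner_product_on_def)
  ultimately have "\<rho> > 0" by (simp add: zero_less_mult_iff)
  moreover have "g v v > 0" using g v by (auto simp: inner_product_on_def)
  ultimately have "\<phi> v \<noteq> 0" using v(4)[OF v(1)] by auto
  have "\<phi> y = g ((\<rho> / \<phi> v) *\<^sub>R v) y" if y: "y \<in> W" for y
    using v(4)[OF y] \<open>\<phi> v \<noteq> 0\<close> form_commute[OF W gs v(1) y]
    by (simp add: form_scaleR_left[OF W gs v(1) y] field_simps)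
  moreover have "(\<rho> / \<phi> v) *\<^sub>R v \<in> W" using W v(1) by (rule subspace_scale)
  ultimately show thesis using that by blast
qed

text \<open>The vectors \<open>u\<close> for which \<open>g(u, \<cdot>)\<close> is proportional to \<open>\<phi>\<close> on every eigenspace form a subspace
  \<open>K\<close> which contains the vector representing \<open>\<phi>\<close> and is invariant under the operator \<open>B\<close> with
  \<open>h(x, y) = g(Bx, y)\<close>: on the \<open>\<sigma>\<close>-eigenspace \<open>g(Bu, \<cdot>) = \<sigma> g(u, \<cdot>)\<close>. Being invariant and
  nonzero, \<open>K\<close> contains an eigenvector of \<open>B\<close>. This finds the required eigenvector without a
  decomposition of \<open>W\<close> into eigenspaces.\<close>

lemma eigenvector_representing_form:
  fixes W :: "'e::euclidean_space set"
  assumes W: "subspace W" and g: "inner_product_on W g" and h: "symmetric_form_on W h"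
    and \<phi>: "linear_form_on W \<phi>" and nz: "x0 \<in> W" "\<phi> x0 \<noteq> 0"
  obtains v \<rho> k where "v \<in> eigenspace_on W g h \<rho>" "v \<noteq> 0" "k \<noteq> 0"
    "\<And>y. y \<in> eigenspace_on W g h \<rho> \<Longrightarrow> \<phi> y = k * g v y"
proof -
  have gs: "symmetric_form_on W g" and gpos: "\<And>x. x \<in> W \<Longrightarrow> x \<noteq> 0 \<Longrightarrow> g x x > 0"
    using g by (auto simp: inner_product_on_def)
  define K where "K = {u\<in>W. \<forall>\<rho>. \<exists>c. \<forall>y\<in>eigenspace_on W g h \<rho>. g u y = c * \<phi> y}"
  have EW: "\<And>y \<rho>. y \<in> eigenspace_on W g h \<rho> \<Longrightarrow> y \<in> W" by (simp add: eigenspace_on_def)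
  have K: "subspace K"
  proof (rule subspaceI)
    have "g 0 y = 0 * \<phi> y" if "y \<in> W" for y
      using form_scaleR_left[OF W gs that that, of 0] by simp
    then show "0 \<in> K" using W EW by (auto simp: K_def subspace_0 intro!: exI[of _ 0])
  next
    fix x y assume x: "x \<in> K" and y: "y \<in> K"
    show "x + y \<in> K"
      unfolding K_def mem_Collect_eq
    proof (intro conjI allI)
      show "x + y \<in> W" using x y W by (simp add: K_def subspace_add)
      fix \<rho>
      obtain c d where "\<forall>z\<in>eigenspace_on W g h \<rho>. g x z = c * \<phi> z"
        "\<forall>z\<in>eigenspace_on W g h \<rho>. g y z = d * \<phi> z"
        using x y unfolding K_def by blast
      then have "\<forall>z\<in>eigenspace_on W g h \<rho>. g (x + y) z = (c + d) * \<phi> z"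
        using x y EW by (simp add: K_def form_simps[OF W gs] distrib_right)
      then show "\<exists>c. \<forall>z\<in>eigenspace_on W g h \<rho>. g (x + y) z = c * \<phi> z" ..
    qed
  next
    fix r x assume x: "x \<in> K"
    show "r *\<^sub>R x \<in> K"
      unfolding K_def mem_Collect_eq
    proof (intro conjI allI)
      show "r *\<^sub>R x \<in> W" using x W by (simp add: K_def subspace_scale)
      fix \<rho>
      obtain c where "\<forall>z\<in>eigenspace_on W g h \<rho>. g x z = c * \<phi> z"
        using x unfolding K_def by blast
      then have "\<forall>z\<in>eigenspace_on W g h \<rho>. g (r *\<^sub>R x) z = (r * c) * \<phi> z"
        using x EW by (simp add: K_def form_simps[OF W gs])
      then show "\<exists>c. \<forall>z\<in>eigenspace_on W g h \<rho>. g (r *\<^sub>R x) z = c * \<phi> z" ..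
    qed
  qed
  have KW: "K \<subseteq> W" by (auto simp: K_def)
  obtain u where u: "u \<in> W" "\<And>y. y \<in> W \<Longrightarrow> \<phi> y = g u y"
    using riesz_on_subspace[OF W g \<phi>] by blast
  have "u \<in> K" using u EW by (auto simp: K_def intro!: exI[of _ 1])
  have "u \<noteq> 0"
  proof
    assume "u = 0"
    then have "\<phi> x0 = g (0 *\<^sub>R x0) x0" using u(2)[OF nz(1)] by simp
    also have "\<dots> = 0" using form_scaleR_left[OF W gs nz(1) nz(1), of 0] by simp
    finally show False using nz by simp
  qed
  have "inner_product_on K g" "symmetric_form_on K h"
    using g h KW unfolding inner_product_on_def symmetric_form_on_def subset_iff by blast+
  from rayleigh_maximizer[OF K \<open>u \<in> K\<close> \<open>u \<noteq> 0\<close> this] obtain v \<rho>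
    where v: "v \<in> K" "v \<noteq> 0" "\<And>y. y \<in> K \<Longrightarrow> h y v = \<rho> * g y v" by metis
  have vW: "v \<in> W" using v KW by blast
  have "linear_form_on W (\<lambda>y. h v y)"
    using vW by (auto simp: linear_form_on_def form_simps[OF W h])
  from riesz_on_subspace[OF W g this] obtain b
    where b: "b \<in> W" "\<And>y. y \<in> W \<Longrightarrow> h v y = g b y" by metis
  have "b \<in> K"
    unfolding K_def mem_Collect_eq
  proof (intro conjI allI)
    show "b \<in> W" by (rule b)
    fix \<sigma>
    obtain c where c: "\<forall>z\<in>eigenspace_on W g h \<sigma>. g v z = c * \<phi> z"
      using v(1) unfolding K_def by blast
    have "\<forall>z\<in>eigenspace_on W g h \<sigma>. g b z = (\<sigma> * c) * \<phi> z"
    proof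
      fix z assume z: "z \<in> eigenspace_on W g h \<sigma>"
      have "g b z = h v z" using b(2) EW[OF z] by simp
      also have "\<dots> = \<sigma> * g v z" using z vW by (simp add: eigenspace_on_def)
      finally show "g b z = (\<sigma> * c) * \<phi> z" using c z by simp
    qed
    then show "\<exists>c. \<forall>z\<in>eigenspace_on W g h \<sigma>. g b z = c * \<phi> z" ..
  qed
  \<comment> \<open>\<open>v\<close> is an eigenvector only in the directions of \<open>K\<close> so far; invariance puts \<open>w = Bv - \<rho>v\<close> in \<open>K\<close>,
    so \<open>w\<close> is orthogonal to itself\<close>
  define w where "w = b - \<rho> *\<^sub>R v"
  have wK: "w \<in> K" using \<open>b \<in> K\<close> v(1) K by (simp add: w_def subspace_diff subspace_scale)
  then have wW: "w \<in> W" using KW by blast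
  have rv: "\<rho> *\<^sub>R v \<in> W" using W vW by (rule subspace_scale)
  have gw: "g w y = h y v - \<rho> * g y v" if "y \<in> W" for y
    using that b vW rv form_commute[OF W h vW that] form_commute[OF W gs vW that]
    by (simp add: w_def form_simps[OF W gs])
  have "g w w = 0" using gw[OF wW] v(3)[OF wK] by simp
  then have "w = 0" using gpos[OF wW] by force
  then have "h y v = \<rho> * g y v" if "y \<in> W" for y
    using gw[OF that] form_scaleR_left[OF W gs wW that, of 0] by simp
  then have vE: "v \<in> eigenspace_on W g h \<rho>" using vW by (simp add: eigenspace_on_def)
  obtain c where c: "\<And>y. y \<in> eigenspace_on W g h \<rho> \<Longrightarrow> g v y = c * \<phi> y"
    using v(1) unfolding K_def by blast
  have "c \<noteq> 0" using c[OF vE] gpos[OF vW v(2)] by auto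
  then have "\<phi> y = inverse c * g v y" if "y \<in> eigenspace_on W g h \<rho>" for y
    using c[OF that] by simp
  with vE v(2) \<open>c \<noteq> 0\<close> show thesis using that[of v \<rho> "inverse c"] by simp
qed

section \<open>The pointwise algebra of PQ-projectivity\<close>

definition pq_difference ::
  "('v \<Rightarrow> real) \<Rightarrow> ('v \<Rightarrow> 'v) \<Rightarrow> ('v \<Rightarrow> 'v) \<Rightarrow> 'v \<Rightarrow> 'v \<Rightarrow> 'v::real_vector" where
  "pq_difference \<phi> P Q x y = \<phi> x *\<^sub>R y + \<phi> y *\<^sub>R x - \<phi> (P x) *\<^sub>R Q y - \<phi> (P y) *\<^sub>R Q x"

text \<open>In the assumption \<open>derivative\<close>, the vectors \<open>a\<close>, \<open>b\<close>, \<open>c\<close>, \<open>d\<close> stand for the covariant derivatives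
  of \<open>PY\<close>, \<open>Z\<close>, \<open>Y\<close>, \<open>PZ\<close> along \<open>X\<close>. Nothing is known about them except that they occur in both
  equations, which suffices: on an eigenspace of \<open>h\<close> relative to \<open>g\<close> the two equations differ only
  by the factor \<open>\<rho>\<close> and by the terms with \<open>pq_difference\<close>.\<close>

lemma pq_constant_cases:
  fixes W :: "'e::euclidean_space set"
  assumes W: "subspace W" and g: "inner_product_on W g" and h: "inner_product_on W h"
    and \<phi>: "linear_form_on W \<phi>" "x0 \<in> W" "\<phi> x0 \<noteq> 0"
    and P: "\<And>x. x \<in> W \<Longrightarrow> P x \<in> W" and Q: "\<And>x. x \<in> W \<Longrightarrow> Q x \<in> W"
    and gP: "\<And>x y. x \<in> W \<Longrightarrow> y \<in> W \<Longrightarrow> g (P x) y = - g x (P y)"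
    and gQ: "\<And>x y. x \<in> W \<Longrightarrow> y \<in> W \<Longrightarrow> g (Q x) y = - g x (Q y)"
    and hP: "\<And>x y. x \<in> W \<Longrightarrow> y \<in> W \<Longrightarrow> h (P x) y = - h x (P y)"
    and PQ: "\<And>x. x \<in> W \<Longrightarrow> P (Q x) = \<epsilon> *\<^sub>R x"
    and derivative: "\<And>x y z. x \<in> W \<Longrightarrow> y \<in> W \<Longrightarrow> z \<in> W \<Longrightarrow>
      \<exists>a\<in>W. \<exists>b\<in>W. \<exists>c\<in>W. \<exists>d\<in>W.
        g a z + g (P y) b + g c (P z) + g y d = 0 \<and>
        h (a + pq_difference \<phi> P Q x (P y)) z + h (P y) (b + pq_difference \<phi> P Q x z) +
        h (c + pq_difference \<phi> P Q x y) (P z) + h y (d + pq_difference \<phi> P Q x (P z)) = 0"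
  shows "\<epsilon> = 0 \<or> \<epsilon> = - 1"
proof -
  have gs: "symmetric_form_on W g" and gpos: "\<And>x. x \<in> W \<Longrightarrow> x \<noteq> 0 \<Longrightarrow> g x x > 0"
    and hs: "symmetric_form_on W h" and hpos: "\<And>x. x \<in> W \<Longrightarrow> x \<noteq> 0 \<Longrightarrow> h x x > 0"
    using g h by (auto simp: inner_product_on_def)
  note comm = form_commute[OF W gs] form_commute[OF W hs]
  let ?S = "pq_difference \<phi> P Q"
  obtain v \<rho> k where vE: "v \<in> eigenspace_on W g h \<rho>" and v0: "v \<noteq> 0" and k: "k \<noteq> 0"
    and \<phi>v: "\<And>y. y \<in> eigenspace_on W g h \<rho> \<Longrightarrow> \<phi> y = k * g v y"
    using eigenvector_representing_form[OF W g hs \<phi>] by metis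
  let ?E = "eigenspace_on W g h \<rho>"
  have EW: "y \<in> W" if "y \<in> ?E" for y using that by (simp add: eigenspace_on_def)
  have eig: "h z y = \<rho> * g z y" "h y z = \<rho> * g y z" if "y \<in> ?E" "z \<in> W" for y z
    using that comm by (auto simp: eigenspace_on_def)
  have vW: "v \<in> W" using EW vE .
  have \<rho>: "\<rho> \<noteq> 0" using hpos[OF vW v0] eig[OF vE vW] by auto
  have PE: "P y \<in> ?E" if y: "y \<in> ?E" for y
  proof -
    have "h z (P y) = \<rho> * g z (P y)" if z: "z \<in> W" for z
      using hP[OF z EW[OF y]] gP[OF z EW[OF y]] eig(1)[OF y P[OF z]] by simp
    then show ?thesis using P EW[OF y] by (simp add: eigenspace_on_def)
  qed
  have SW: "?S x y \<in> W" if "x \<in> W" "y \<in> W" for x y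
    using that W P Q by (simp add: pq_difference_def subspace_add subspace_diff subspace_scale)
  have identity: "g (?S x (P y)) z + g (P y) (?S x z) + g (?S x y) (P z) + g y (?S x (P z)) = 0"
    if x: "x \<in> W" and y: "y \<in> ?E" and z: "z \<in> ?E" for x y z
  proof -
    have yW: "y \<in> W" and zW: "z \<in> W" using EW y z by auto
    obtain a b c d where abcd: "a \<in> W" "b \<in> W" "c \<in> W" "d \<in> W"
      and 1: "g a z + g (P y) b + g c (P z) + g y d = 0"
      and 2: "h (a + ?S x (P y)) z + h (P y) (b + ?S x z) +
        h (c + ?S x y) (P z) + h y (d + ?S x (P z)) = 0"
      using derivative[OF x yW zW] by blast
    have "\<rho> * (g (a + ?S x (P y)) z + g (P y) (b + ?S x z) +
        g (c + ?S x y) (P z) + g y (d + ?S x (P z))) = 0"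
      using 2 abcd x yW zW W SW P
      by (simp add: eig[OF y] eig[OF z] eig[OF PE[OF y]] eig[OF PE[OF z]] subspace_add
          distrib_left)
    then show ?thesis
      using 1 \<rho> abcd x yW zW SW P by (simp add: form_simps[OF W gs])
  qed
  \<comment> \<open>All values needed for \<open>x = y = v\<close>, \<open>z = P v\<close>. The values of \<open>\<phi>\<close> are available because
    \<open>v\<close>, \<open>P v\<close>, \<open>P (P v)\<close> lie in the eigenspace; \<open>Q v\<close> only enters through \<open>g\<close>.\<close>
  define n where "n = g v v"
  define q where "q = g (P v) (P v)"
  have mems: "v \<in> W" "P v \<in> W" "P (P v) \<in> W" "P (P (P v)) \<in> W" "Q v \<in> W" "Q (P v) \<in> W"
    "Q (P (P v)) \<in> W" using vW P Q by auto
  have vals: "g v (P v) = 0" "g (P v) v = 0" "g v (Q v) = 0" "g (Q v) v = 0"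
    "g v (P (P v)) = - q" "g (P (P v)) v = - q"
    "g (P v) (Q v) = - \<epsilon> * n" "g (Q v) (P v) = - \<epsilon> * n"
    using gP[of v v] gQ[of v v] gP[of v "P v"] gP[of "Q v" v] gP[of v "Q v"] comm[of v "P v"] comm[of v "Q v"]
      comm[of v "P (P v)"] comm[of "P v" "Q v"] mems PQ[OF vW]
    by (auto simp: n_def q_def form_simps[OF W gs])
  have \<phi>s: "\<phi> v = k * n" "\<phi> (P v) = 0" "\<phi> (P (P v)) = - k * q"
    using \<phi>v[OF vE] \<phi>v[OF PE[OF vE]] \<phi>v[OF PE[OF PE[OF vE]]] vals by (auto simp: n_def)
  have "2 * k * n * q * (1 + \<epsilon>) = 0"
    using identity[OF vW vE PE[OF vE]] mems vals W gQ[of "P v" "P v"] gQ[of v "P (P v)"]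
      gQ[of "P (P v)" v] comm[of "Q (P (P v))" v] comm[of "Q v" "P (P v)"]
    by (simp add: pq_difference_def form_simps[OF W gs] subspace_add subspace_diff subspace_scale
        \<phi>s n_def[symmetric] q_def[symmetric] algebra_simps)
  moreover have "n \<noteq> 0" using gpos[OF vW v0] by (simp add: n_def)
  ultimately consider "\<epsilon> = - 1" | "q = 0" using k by auto
  then show ?thesis
  proof cases
    case 2
    have "P v = 0" using 2 gpos[OF mems(2)] by (force simp: q_def)
    then have "g (P v) (Q v) = 0"
      using form_scaleR_left[OF W gs mems(2) mems(5), of 0] by simp
    then show ?thesis using vals(7) \<open>n \<noteq> 0\<close> by simp
  qed simp
qed


section \<open>Smooth functions on open sets\<close>

lemma frechet_derivative_eqI:
  assumes "open S" "x \<in> S" "\<And>y. y \<in> S \<Longrightarrow> f y = g y" "g differentiable (at x)"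
  shows "frechet_derivative f (at x) = frechet_derivative g (at x)"
proof -
  have "(g has_derivative frechet_derivative g (at x)) (at x)"
    using assms(4) by (simp add: frechet_derivative_works)
  then have "(f has_derivative frechet_derivative g (at x)) (at x)"
    by (rule has_derivative_transform_within_open[OF _ assms(1,2)]) (simp add: assms(3))
  from frechet_derivative_at[OF this] show ?thesis by (rule sym)
qed

lemma differentiable_transform_open:
  assumes "open S" "x \<in> S" "\<And>y. y \<in> S \<Longrightarrow> f y = g y" "g differentiable (at x)"
  shows "f differentiable (at x)"
proof -
  obtain g' where "(g has_derivative g') (at x)"
    using assms(4) by (auto simp: differentiable_def)
  then have "(f has_derivative g') (at x)"
    by (rule has_derivative_transform_within_open[OF _ assms(1,2)]) (simp add: assms(3))
  then show ?thesis by (auto simp: differentiable_def)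
qed

text \<open>Openness of \<open>S\<close> matters: the derivatives at points of \<open>S\<close> are taken in the whole space, and only
  for open \<open>S\<close> they are determined by the values on \<open>S\<close>.\<close>

lemma Ck_on_cong:
  assumes "open S" "\<And>x. x \<in> S \<Longrightarrow> f x = g x" "Ck_on k g S"
  shows "Ck_on k f S"
  using assms(2,3)
proof (induction k arbitrary: f g)
  case 0
  then show ?case using continuous_on_cong[OF refl 0(1)] by simp
next
  case (Suc k)
  have "f differentiable (at x)" if "x \<in> S" for x
    using differentiable_transform_open[OF assms(1) that Suc.prems(1)] Suc.prems(2) that by simp
  moreover have "Ck_on k (\<lambda>x. frechet_derivative f (at x) v) S" for v
  proof (rule Suc.IH)
    show "Ck_on k (\<lambda>x. frechet_derivative g (at x) v) S" using Suc.prems(2) by simp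
    fix x assume "x \<in> S"
    then show "frechet_derivative f (at x) v = frechet_derivative g (at x) v"
      using frechet_derivative_eqI[OF assms(1) _ Suc.prems(1)] Suc.prems(2) by simp
  qed
  ultimately show ?case by simp
qed

lemma Ck_on_add:
  assumes "open S" "Ck_on k f S" "Ck_on k g S"
  shows "Ck_on k (\<lambda>x. f x + g x) S"
  using assms(2,3)
proof (induction k arbitrary: f g)
  case 0
  then show ?case by (simp add: continuous_on_add)
next
  case (Suc k)
  then have diff: "\<And>x. x \<in> S \<Longrightarrow> f differentiable (at x)" "\<And>x. x \<in> S \<Longrightarrow> g differentiable (at x)"
    by simp_all
  have "Ck_on k (\<lambda>x. frechet_derivative (\<lambda>x. f x + g x) (at x) v) S" for v
  proof (rule Ck_on_cong[OF assms(1)])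
    show "Ck_on k (\<lambda>x. frechet_derivative f (at x) v + frechet_derivative g (at x) v) S"
      using Suc.prems by (intro Suc.IH) simp_all
    fix x assume "x \<in> S"
    then have "((\<lambda>x. f x + g x) has_derivative
        (\<lambda>v. frechet_derivative f (at x) v + frechet_derivative g (at x) v)) (at x)"
      using diff by (intro has_derivative_add) (simp_all add: frechet_derivative_works[symmetric])
    from frechet_derivative_at[OF this]
    show "frechet_derivative (\<lambda>x. f x + g x) (at x) v =
        frechet_derivative f (at x) v + frechet_derivative g (at x) v"
      by (simp add: fun_eq_iff)
  qed
  with diff show ?case by simp
qed

lemma Ck_on_scaleR:
  assumes "open S" "Ck_on k f S"
  shows "Ck_on k (\<lambda>x. r *\<^sub>R f x) S"
  using assms(2)
proof (induction k arbitrary: f)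
  case 0
  then show ?case by (simp add: continuous_on_scaleR)
next
  case (Suc k)
  then have diff: "\<And>x. x \<in> S \<Longrightarrow> f differentiable (at x)" by simp
  have "Ck_on k (\<lambda>x. frechet_derivative (\<lambda>x. r *\<^sub>R f x) (at x) v) S" for v
  proof (rule Ck_on_cong[OF assms(1)])
    show "Ck_on k (\<lambda>x. r *\<^sub>R frechet_derivative f (at x) v) S"
      using Suc.prems by (intro Suc.IH) simp_all
    fix x assume "x \<in> S"
    then have "(f has_derivative frechet_derivative f (at x)) (at x)"
      using diff by (simp add: frechet_derivative_works)
    then have "((\<lambda>x. r *\<^sub>R f x) has_derivative (\<lambda>v. r *\<^sub>R frechet_derivative f (at x) v)) (at x)"
      by (rule has_derivative_scaleR_right)
    from frechet_derivative_at[OF this]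
    show "frechet_derivative (\<lambda>x. r *\<^sub>R f x) (at x) v = r *\<^sub>R frechet_derivative f (at x) v"
      by (simp add: fun_eq_iff)
  qed
  with diff show ?case by simp
qed

lemma smooth_on_differentiable:
  assumes "smooth_on f S" "x \<in> S"
  shows "f differentiable (at x)"
proof -
  have "Ck_on (Suc 0) f S" using assms(1) unfolding smooth_on_def by blast
  with assms(2) show ?thesis by simp
qed

section \<open>Tangent vectors, vector fields and derivations\<close>

lemma coord_inv_mem: "x \<in> snd c ` fst c \<Longrightarrow> coord_inv c x \<in> fst c"
  unfolding coord_inv_def by (rule inv_into_into)

context
  fixes T :: "'a topology" and A :: "('a, 'e::euclidean_space) chart set"
  assumes atlas: "smooth_atlas T A"
begin

lemma chart_domain_subset: "c \<in> A \<Longrightarrow> fst c \<subseteq> topspace T"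
  and chart_image_open: "c \<in> A \<Longrightarrow> open (snd c ` fst c)"
  using atlas unfolding smooth_atlas_def by (auto dest: openin_subset)

lemma transition_derivative_linear:
  assumes "c \<in> A" "d \<in> A" "p \<in> fst c" "p \<in> fst d"
  shows "linear (frechet_derivative (transition c d) (at (snd c p)))"
proof -
  have "smooth_on (transition c d) (snd c ` (fst c \<inter> fst d))"
    using atlas assms unfolding smooth_atlas_def by blast
  then show ?thesis
    using assms by (intro linear_frechet_derivative smooth_on_differentiable) auto
qed

lemma tangent_space_transform:
  assumes "v \<in> tangent_space A p" "c \<in> A" "d \<in> A" "p \<in> fst c" "p \<in> fst d"
  shows "v d = frechet_derivative (transition c d) (at (snd c p)) (v c)"
  using assms unfolding tangent_space_def mem_Collect_eq by blast

lemma tangent_space_outside: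
  assumes "v \<in> tangent_space A p" "\<not> (c \<in> A \<and> p \<in> fst c)"
  shows "v c = 0"
  using assms unfolding tangent_space_def mem_Collect_eq by blast

lemma tangent_spaceI:
  assumes "\<And>c d. c \<in> A \<Longrightarrow> d \<in> A \<Longrightarrow> p \<in> fst c \<Longrightarrow> p \<in> fst d \<Longrightarrow>
      v d = frechet_derivative (transition c d) (at (snd c p)) (v c)"
    and "\<And>c. \<not> (c \<in> A \<and> p \<in> fst c) \<Longrightarrow> v c = 0"
  shows "v \<in> tangent_space A p"
  using assms unfolding tangent_space_def mem_Collect_eq by blast

lemma tangent_space_tadd:
  assumes "v \<in> tangent_space A p" "w \<in> tangent_space A p"
  shows "v \<oplus>\<^sub>t w \<in> tangent_space A p"
proof (rule tangent_spaceI)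
  fix c d assume cd: "c \<in> A" "d \<in> A" "p \<in> fst c" "p \<in> fst d"
  show "(v \<oplus>\<^sub>t w) d = frechet_derivative (transition c d) (at (snd c p)) ((v \<oplus>\<^sub>t w) c)"
    unfolding tadd_def linear_add[OF transition_derivative_linear[OF cd]]
    using assms[THEN tangent_space_transform, OF cd] by (rule arg_cong2)
next
  fix c assume "\<not> (c \<in> A \<and> p \<in> fst c)"
  from assms[THEN tangent_space_outside, OF this] show "(v \<oplus>\<^sub>t w) c = 0"
    by (simp add: tadd_def)
qed

lemma tangent_space_tscale:
  assumes "v \<in> tangent_space A p"
  shows "r \<odot>\<^sub>t v \<in> tangent_space A p"
proof (rule tangent_spaceI)
  fix c d assume cd: "c \<in> A" "d \<in> A" "p \<in> fst c" "p \<in> fst d"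
  show "(r \<odot>\<^sub>t v) d = frechet_derivative (transition c d) (at (snd c p)) ((r \<odot>\<^sub>t v) c)"
    unfolding tscale_def linear_cmul[OF transition_derivative_linear[OF cd]]
    using tangent_space_transform[OF assms cd] by (rule arg_cong)
next
  fix c assume "\<not> (c \<in> A \<and> p \<in> fst c)"
  from tangent_space_outside[OF assms this] show "(r \<odot>\<^sub>t v) c = 0"
    by (simp add: tscale_def)
qed

lemma tangent_vector_eqI:
  assumes "v \<in> tangent_space A p" "w \<in> tangent_space A p" "c \<in> A" "p \<in> fst c" "v c = w c"
  shows "v = w"
proof
  fix d
  show "v d = w d"
  proof (cases "d \<in> A \<and> p \<in> fst d")
    case True
    then show ?thesis
      using assms(5) tangent_space_transform[OF assms(1) assms(3) _ assms(4)]
        tangent_space_transform[OF assms(2) assms(3) _ assms(4)] by simp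
  next
    case False
    then show ?thesis
      using tangent_space_outside[OF assms(1)] tangent_space_outside[OF assms(2)] by simp
  qed
qed

lemma vector_field_tangent: "X \<in> vector_fields T A \<Longrightarrow> p \<in> topspace T \<Longrightarrow> X p \<in> tangent_space A p"
  by (simp add: vector_fields_def)

lemma vector_fieldsI:
  assumes "\<And>q. q \<in> topspace T \<Longrightarrow> X q \<in> tangent_space A q"
    and "\<And>c k. c \<in> A \<Longrightarrow> Ck_on k (\<lambda>x. X (coord_inv c x) c) (snd c ` fst c)"
  shows "X \<in> vector_fields T A"
  using assms by (simp add: vector_fields_def smooth_on_def)

lemma vector_field_Ck_on:
  "X \<in> vector_fields T A \<Longrightarrow> c \<in> A \<Longrightarrow> Ck_on k (\<lambda>x. X (coord_inv c x) c) (snd c ` fst c)"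
  by (simp add: vector_fields_def smooth_on_def)

lemma vector_fields_tadd:
  assumes "X \<in> vector_fields T A" "Y \<in> vector_fields T A"
  shows "(\<lambda>q. X q \<oplus>\<^sub>t Y q) \<in> vector_fields T A"
proof (rule vector_fieldsI)
  show "X q \<oplus>\<^sub>t Y q \<in> tangent_space A q" if "q \<in> topspace T" for q
    using that assms by (intro tangent_space_tadd vector_field_tangent)
  show "Ck_on k (\<lambda>x. (X (coord_inv c x) \<oplus>\<^sub>t Y (coord_inv c x)) c) (snd c ` fst c)"
    if "c \<in> A" for c k
    unfolding tadd_def using that assms by (intro Ck_on_add chart_image_open vector_field_Ck_on)
qed

lemma vector_fields_tscale:
  assumes "X \<in> vector_fields T A"
  shows "(\<lambda>q. r \<odot>\<^sub>t X q) \<in> vector_fields T A"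
proof (rule vector_fieldsI)
  show "r \<odot>\<^sub>t X q \<in> tangent_space A q" if "q \<in> topspace T" for q
    using that assms by (intro tangent_space_tscale vector_field_tangent)
  show "Ck_on k (\<lambda>x. (r \<odot>\<^sub>t X (coord_inv c x)) c) (snd c ` fst c)" if "c \<in> A" for c k
    unfolding tscale_def using that assms
    by (intro Ck_on_scaleR chart_image_open vector_field_Ck_on)
qed

text \<open>Off the manifold \<open>f'\<close> and \<open>- f\<close> may differ, so the derivatives are compared through the chart,
  whose image is an open set on which the two agree.\<close>

lemma tderiv_minus:
  assumes "p \<in> topspace T" "smooth_fun A f" "\<And>q. q \<in> topspace T \<Longrightarrow> f' q = - f q"
  shows "tderiv A p v f' = - tderiv A p v f"
proof -
  define c where "c = (SOME c. c \<in> A \<and> p \<in> fst c)"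
  have "\<exists>c. c \<in> A \<and> p \<in> fst c"
    using atlas assms(1) unfolding smooth_atlas_def by blast
  then have c: "c \<in> A" "p \<in> fst c" using someI_ex[of "\<lambda>c. c \<in> A \<and> p \<in> fst c"] by (simp_all add: c_def)
  let ?S = "snd c ` fst c" and ?x = "snd c p"
  have S: "open ?S" "?x \<in> ?S" using chart_image_open c by auto
  have "(f \<circ> coord_inv c) differentiable (at ?x)"
    using assms(2) c S by (auto simp: smooth_fun_def intro: smooth_on_differentiable)
  then have "((f \<circ> coord_inv c) has_derivative frechet_derivative (f \<circ> coord_inv c) (at ?x)) (at ?x)"
    by (rule frechet_derivative_works[THEN iffD1])
  then have "((\<lambda>x. - (f \<circ> coord_inv c) x) has_derivative
      (\<lambda>v. - frechet_derivative (f \<circ> coord_inv c) (at ?x) v)) (at ?x)"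
    by (rule has_derivative_minus)
  then have "((f' \<circ> coord_inv c) has_derivative
      (\<lambda>v. - frechet_derivative (f \<circ> coord_inv c) (at ?x) v)) (at ?x)"
    by (rule has_derivative_transform_within_open[OF _ S])
      (simp add: assms(3) subsetD[OF chart_domain_subset[OF c(1)] coord_inv_mem])
  from frechet_derivative_at[OF this] show ?thesis
    by (simp add: tderiv_def c_def[symmetric] Let_def fun_eq_iff)
qed

text \<open>This is the derivative along \<open>X\<close> of the identity \<open>g(PY, Z) = - g(Y, PZ)\<close>, expanded by the
  compatibility of \<open>D\<close> with \<open>g\<close>.\<close>

lemma metric_compatible_skew_derivative:
  assumes g: "riemannian_metric T A g"
    and D: "levi_civita_connection T A g D" and P: "endo_field T A P"
    and skew: "skew_wrt T A g P" and p: "p \<in> topspace T"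
    and VF: "X \<in> vector_fields T A" "Y \<in> vector_fields T A" "Z \<in> vector_fields T A"
  shows "g p (D X (\<lambda>q. P q (Y q)) p) (Z p) + g p (P p (Y p)) (D X Z p) +
    g p (D X Y p) (P p (Z p)) + g p (Y p) (D X (\<lambda>q. P q (Z q)) p) = 0"
proof -
  let ?PY = "\<lambda>q. P q (Y q)" and ?PZ = "\<lambda>q. P q (Z q)"
  have PV: "?PY \<in> vector_fields T A" "?PZ \<in> vector_fields T A"
    using P VF by (simp_all add: endo_field_def)
  have leibniz: "tderiv A p (X p) (\<lambda>q. g q (U q) (V q)) =
      g p (D X U p) (V p) + g p (U p) (D X V p)"
    if "U \<in> vector_fields T A" "V \<in> vector_fields T A" for U V
    using D VF(1) p that by (simp add: levi_civita_connection_def)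
  have "tderiv A p (X p) (\<lambda>q. g q (?PY q) (Z q)) = - tderiv A p (X p) (\<lambda>q. g q (Y q) (?PZ q))"
  proof (rule tderiv_minus[OF p])
    show "smooth_fun A (\<lambda>q. g q (Y q) (?PZ q))"
      using g VF PV by (simp add: riemannian_metric_def)
    show "g q (?PY q) (Z q) = - g q (Y q) (?PZ q)" if "q \<in> topspace T" for q
      using skew VF that by (simp add: skew_wrt_def vector_field_tangent)
  qed
  then show ?thesis using leibniz VF PV by simp
qed

end

section \<open>PQ-projective metrics\<close>

theorem theorem1:
  fixes T :: "'a topology"
    and A :: "('a, 'e::euclidean_space) chart set"
    and g g' :: "'a \<Rightarrow> ('a, 'e) tvec \<Rightarrow> ('a, 'e) tvec \<Rightarrow> real"
    and D D' :: "('a \<Rightarrow> ('a, 'e) tvec) \<Rightarrow> ('a \<Rightarrow> ('a, 'e) tvec) \<Rightarrow> 'a \<Rightarrow> ('a, 'e) tvec"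
    and P Q :: "'a \<Rightarrow> ('a, 'e) tvec \<Rightarrow> ('a, 'e) tvec"
    and \<epsilon> :: real
  assumes "smooth_manifold T A"
    and "riemannian_metric T A g"
    and "riemannian_metric T A g'"
    and "levi_civita_connection T A g D"
    and "levi_civita_connection T A g' D'"
    and "endo_field T A P"
    and "endo_field T A Q"
    and "pq_compatible T A g g' P Q \<epsilon>"
    and "\<epsilon> \<noteq> 1"
    and "\<epsilon> \<noteq> real DIM('e) + 1"
    and "pq_projective T A D D' P Q"
    and "\<not> affinely_equivalent T A D D'"
  shows "\<epsilon> = 0 \<or> (\<exists>n::int. n < 0 \<and> odd n \<and> \<epsilon> = real_of_int n)"
proof -
  let ?VF = "vector_fields T A"
  have atlas: "smooth_atlas T A" using assms(1) by (simp add: smooth_manifold_def)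
  obtain \<Phi> where \<Phi>: "one_form T A \<Phi>"
    and diff: "\<And>X Y p. X \<in> ?VF \<Longrightarrow> Y \<in> ?VF \<Longrightarrow> p \<in> topspace T \<Longrightarrow>
      D' X Y p \<ominus>\<^sub>t D X Y p =
        \<Phi> p (X p) \<odot>\<^sub>t Y p \<oplus>\<^sub>t \<Phi> p (Y p) \<odot>\<^sub>t X p
          \<ominus>\<^sub>t \<Phi> p (P p (X p)) \<odot>\<^sub>t Q p (Y p) \<ominus>\<^sub>t \<Phi> p (P p (Y p)) \<odot>\<^sub>t Q p (X p)"
    using assms(11) unfolding pq_projective_def by blast
  obtain X0 Y0 p where X0: "X0 \<in> ?VF" and Y0: "Y0 \<in> ?VF" and p: "p \<in> topspace T"
    and neq: "D X0 Y0 p \<noteq> D' X0 Y0 p"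
    using assms(12) unfolding affinely_equivalent_def by blast
  obtain c where c: "c \<in> A" "p \<in> fst c"
    using atlas p unfolding smooth_atlas_def by blast
  have PV: "(\<lambda>q. P q (X q)) \<in> ?VF" and QV: "(\<lambda>q. Q q (X q)) \<in> ?VF" if "X \<in> ?VF" for X
    using assms(6,7) that by (simp_all add: endo_field_def)
  have DV: "D X Y \<in> ?VF" and DV': "D' X Y \<in> ?VF" if "X \<in> ?VF" "Y \<in> ?VF" for X Y
    using assms(4,5) that by (simp_all add: levi_civita_connection_def affine_connection_def)
  note tangent = vector_field_tangent[OF atlas _ p]

  \<comment> \<open>\<open>W\<close> consists of the coordinates, in the chart \<open>c\<close>, of the values at \<open>p\<close> of global fields, and
    \<open>F x\<close> is some field with value \<open>x\<close>. The fields themselves are not linear in \<open>x\<close>, but their values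
    at \<open>p\<close> are, because a tangent vector is determined by its components in one chart.\<close>
  define W where "W = (\<lambda>X. X p c) ` ?VF"
  define F where "F = inv_into ?VF (\<lambda>X. X p c)"
  have F: "F x \<in> ?VF" "F x p c = x" if "x \<in> W" for x
    using that unfolding W_def F_def by (rule inv_into_into, rule f_inv_into_f)
  have WI: "X p c \<in> W" if "X \<in> ?VF" for X using that by (auto simp: W_def)
  have F_eq: "F x p = X p" if "X \<in> ?VF" "X p c = x" for X x
    using that(2) F[OF WI[OF that(1)]]
    by (intro tangent_vector_eqI[OF atlas tangent tangent c]) (simp_all add: that(1))
  have add: "F (x + y) p = F x p \<oplus>\<^sub>t F y p \<and> x + y \<in> W" if "x \<in> W" "y \<in> W" for x y
  proof -
    have field: "(\<lambda>q. F x q \<oplus>\<^sub>t F y q) \<in> ?VF"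
      using that by (intro vector_fields_tadd[OF atlas] F(1))
    have val: "(F x p \<oplus>\<^sub>t F y p) c = x + y" using that by (simp add: tadd_def F(2))
    show ?thesis using F_eq[OF field val] WI[OF field] unfolding val by blast
  qed
  have scale: "F (r *\<^sub>R x) p = r \<odot>\<^sub>t F x p \<and> r *\<^sub>R x \<in> W" if "x \<in> W" for r x
  proof -
    have field: "(\<lambda>q. r \<odot>\<^sub>t F x q) \<in> ?VF"
      using that by (intro vector_fields_tscale[OF atlas] F(1))
    have val: "(r \<odot>\<^sub>t F x p) c = r *\<^sub>R x" using that by (simp add: tscale_def F(2))
    show ?thesis using F_eq[OF field val] WI[OF field] unfolding val by blast
  qed
  note F_add = add[THEN conjunct1] and F_scale = scale[THEN conjunct1]
  have Ft: "F x p \<in> tangent_space A p" if "x \<in> W" for x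
    using tangent F that by simp
  have W: "subspace W"
    using scale[OF WI[OF X0], of 0] by (intro subspaceI add[THEN conjunct2] scale[THEN conjunct2]) simp

  define G where "G k x y = (k p (F x p) (F y p) :: real)" for k x y
  define \<phi> where "\<phi> x = \<Phi> p (F x p)" for x
  define P0 where "P0 x = P p (F x p) c" for x
  define Q0 where "Q0 x = Q p (F x p) c" for x
  have FP: "F (P0 x) p = P p (F x p)" and P0: "P0 x \<in> W"
    and FQ: "F (Q0 x) p = Q p (F x p)" and Q0: "Q0 x \<in> W" if "x \<in> W" for x
    unfolding P0_def Q0_def
    by (rule F_eq[OF PV[OF F(1)[OF that]] refl] WI[OF PV[OF F(1)[OF that]]]
      F_eq[OF QV[OF F(1)[OF that]] refl] WI[OF QV[OF F(1)[OF that]]])+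
  have G: "inner_product_on W (G k)" if k: "riemannian_metric T A k" for k
  proof -
    have "F x p \<noteq> tzero" if "x \<in> W" "x \<noteq> 0" for x
      using F(2)[OF that(1)] that(2) by (auto simp: tzero_def)
    moreover have "k p (u \<oplus>\<^sub>t v) w = k p u w + k p v w"
      if "u \<in> tangent_space A p" "v \<in> tangent_space A p" "w \<in> tangent_space A p" for u v w
      using k p that unfolding riemannian_metric_def by blast
    moreover have "k p (r \<odot>\<^sub>t v) w = r * k p v w" "k p v w = k p w v"
      if "v \<in> tangent_space A p" "w \<in> tangent_space A p" for v w r
      using k p that unfolding riemannian_metric_def by blast+
    moreover have "k p v v > 0" if "v \<in> tangent_space A p" "v \<noteq> tzero" for v
      using k p that unfolding riemannian_metric_def by blast
    ultimately show ?thesis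
      using Ft unfolding inner_product_on_def symmetric_form_on_def G_def
      by (intro conjI ballI allI impI) (simp_all add: F_add F_scale)
  qed
  have \<phi>: "linear_form_on W \<phi>"
  proof -
    have "\<Phi> p (v \<oplus>\<^sub>t w) = \<Phi> p v + \<Phi> p w"
      if "v \<in> tangent_space A p" "w \<in> tangent_space A p" for v w
      using \<Phi> p that unfolding one_form_def by blast
    moreover have "\<Phi> p (r \<odot>\<^sub>t v) = r * \<Phi> p v" if "v \<in> tangent_space A p" for v r
      using \<Phi> p that unfolding one_form_def by blast
    ultimately show ?thesis
      using Ft unfolding linear_form_on_def \<phi>_def
      by (intro conjI ballI allI) (simp_all add: F_add F_scale)
  qed
  have D'_eq: "D' X Y p c = D X Y p c + pq_difference \<phi> P0 Q0 (X p c) (Y p c)"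
    if X: "X \<in> ?VF" and Y: "Y \<in> ?VF" for X Y
  proof -
    have "\<phi> (X p c) = \<Phi> p (X p)" "\<phi> (P0 (X p c)) = \<Phi> p (P p (X p))" "Q0 (X p c) = Q p (X p) c"
      if "X \<in> ?VF" for X
      unfolding \<phi>_def Q0_def FP[OF WI[OF that]] F_eq[OF that refl] by (rule refl)+
    note vals = this[OF X] this[OF Y]
    have "D' X Y p c - D X Y p c = pq_difference \<phi> P0 Q0 (X p c) (Y p c)"
      using fun_cong[OF diff[OF X Y p], of c]
      unfolding pq_difference_def vals tdiff_def tadd_def tscale_def .
    then show ?thesis by (simp add: algebra_simps)
  qed
  have "\<exists>x0\<in>W. \<phi> x0 \<noteq> 0"
  proof (rule ccontr)
    assume "\<not> ?thesis"
    then have "D' X0 Y0 p c = D X0 Y0 p c"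
      using D'_eq[OF X0 Y0] WI[OF X0] WI[OF Y0] P0 by (simp add: pq_difference_def)
    then have "D' X0 Y0 p = D X0 Y0 p"
      by (intro tangent_vector_eqI[OF atlas tangent tangent c] DV DV' X0 Y0)
    with neq show False by simp
  qed
  then obtain x0 where x0: "x0 \<in> W" "\<phi> x0 \<noteq> 0" by blast
  have skew: "skew_wrt T A g P" "skew_wrt T A g Q" "skew_wrt T A g' P"
    and PQ: "\<And>v. v \<in> tangent_space A p \<Longrightarrow> P p (Q p v) = \<epsilon> \<odot>\<^sub>t v"
    using assms(8) p by (auto simp: pq_compatible_def)
  have "\<epsilon> = 0 \<or> \<epsilon> = - 1"
  proof (rule pq_constant_cases[OF W G[OF assms(2)] G[OF assms(3)] \<phi> x0])
    show "P0 x \<in> W" "Q0 x \<in> W" if "x \<in> W" for x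
      using that P0 Q0 by auto
    show "G g (P0 x) y = - G g x (P0 y)" "G g (Q0 x) y = - G g x (Q0 y)"
      "G g' (P0 x) y = - G g' x (P0 y)" if "x \<in> W" "y \<in> W" for x y
      using skew p Ft that by (simp_all add: skew_wrt_def G_def FP FQ)
    show "P0 (Q0 x) = \<epsilon> *\<^sub>R x" if "x \<in> W" for x
      using PQ[OF Ft[OF that]] F(2)[OF that] by (simp add: P0_def FQ[OF that] tscale_def)
  next
    fix x y z assume xyz: "x \<in> W" "y \<in> W" "z \<in> W"
    let ?X = "F x" and ?Y = "F y" and ?Z = "F z"
    let ?PY = "\<lambda>q. P q (F y q)" and ?PZ = "\<lambda>q. P q (F z q)"
    note FV = F(1)[OF xyz(1)] F(1)[OF xyz(2)] F(1)[OF xyz(3)]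
    have D'_F: "F (D ?X U p c + pq_difference \<phi> P0 Q0 x (U p c)) p = D' ?X U p" if "U \<in> ?VF" for U
      by (intro F_eq DV' FV that) (simp only: D'_eq[OF FV(1) that] F(2)[OF xyz(1)])
    \<comment> \<open>Tensor arguments only see values at \<open>p\<close>, so the covariant derivatives may be replaced by the
      representatives of their values at \<open>p\<close>.\<close>
    note D'_Fs = D'_F[OF PV[OF FV(2)], folded P0_def] D'_F[OF PV[OF FV(3)], folded P0_def]
      D'_F[OF FV(2), unfolded F(2)[OF xyz(2)]] D'_F[OF FV(3), unfolded F(2)[OF xyz(3)]]
    note D_F = F_eq[OF DV[OF FV(1)] refl]
    have "G g (D ?X ?PY p c) z + G g (P0 y) (D ?X ?Z p c) + G g (D ?X ?Y p c) (P0 z)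
        + G g y (D ?X ?PZ p c) = 0"
      using metric_compatible_skew_derivative[OF atlas assms(2,4,6) skew(1) p FV]
      unfolding G_def D_F[OF FV(2)] D_F[OF FV(3)] D_F[OF PV[OF FV(2)]] D_F[OF PV[OF FV(3)]]
        FP[OF xyz(2)] FP[OF xyz(3)] .
    moreover have "G g' (D ?X ?PY p c + pq_difference \<phi> P0 Q0 x (P0 y)) z
        + G g' (P0 y) (D ?X ?Z p c + pq_difference \<phi> P0 Q0 x z)
        + G g' (D ?X ?Y p c + pq_difference \<phi> P0 Q0 x y) (P0 z)
        + G g' y (D ?X ?PZ p c + pq_difference \<phi> P0 Q0 x (P0 z)) = 0"
      using metric_compatible_skew_derivative[OF atlas assms(3,5,6) skew(3) p FV]
      unfolding G_def D'_Fs FP[OF xyz(2)] FP[OF xyz(3)] .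
    ultimately show "\<exists>a\<in>W. \<exists>b\<in>W. \<exists>c\<in>W. \<exists>d\<in>W.
        G g a z + G g (P0 y) b + G g c (P0 z) + G g y d = 0 \<and>
        G g' (a + pq_difference \<phi> P0 Q0 x (P0 y)) z
          + G g' (P0 y) (b + pq_difference \<phi> P0 Q0 x z)
          + G g' (c + pq_difference \<phi> P0 Q0 x y) (P0 z)
          + G g' y (d + pq_difference \<phi> P0 Q0 x (P0 z)) = 0"
      by (intro bexI[of _ "D ?X ?PY p c"] bexI[of _ "D ?X ?Z p c"] bexI[of _ "D ?X ?Y p c"]
          bexI[of _ "D ?X ?PZ p c"] conjI WI DV FV PV)
  qed
  then show ?thesis
  proof
    assume "\<epsilon> = - 1"
    then have "(-1::int) < 0 \<and> odd (-1::int) \<and> \<epsilon> = real_of_int (-1)" by simp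
    then show ?thesis by blast
  qed simp
qed
end
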